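(* Let $s,t$ be real numbers with $t\geqslant 11$, and let $\Gamma$ be a connected nonregular graph whose adjacency matrix has precisely the three distinct eigenvalues $s>1>-t$, such that $\Gamma$ is not a cone and $\Gamma$ is not biregular. Then the minimum valency of $\Gamma$ satisfies $\delta(\Gamma)\geqslant t+3$.
   Context: A graph on $n$ vertices is a cone if it has a vertex of degree $n-1$. A graph is biregular if it has precisely two distinct vertex valencies. $\delta(\Gamma)$ denotes the smallest valency of $\Gamma$. *)

theory Defs
  imports "Graph_Theory.Graph_Theory" "Jordan_Normal_Form.Spectral_Radius"
begin

text \<open>
  A finite simple undirected graph is a \<^locale>\<open>graph\<close>, i.e. a finite loop-free symmetric
  digraph without parallel arcs: the edge \<open>uv\<close> is the pair of opposite arcs between \<open>u\<close>
  and \<open>v\<close>. Hence the valency of a vertex is its \<^const>\<open>out_degree\<close>.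
\<close>

definition valencies :: "('v, 'e) pre_digraph \<Rightarrow> nat set" where
  "valencies G = out_degree G ` verts G"

definition regular :: "('v, 'e) pre_digraph \<Rightarrow> bool" where
  "regular G \<longleftrightarrow> (\<exists>k. \<forall>v \<in> verts G. out_degree G v = k)"

definition biregular :: "('v, 'e) pre_digraph \<Rightarrow> bool" where
  "biregular G \<longleftrightarrow> card (valencies G) = 2"

definition cone :: "('v, 'e) pre_digraph \<Rightarrow> bool" where
  "cone G \<longleftrightarrow> (\<exists>v \<in> verts G. out_degree G v = card (verts G) - 1)"

definition min_valency :: "('v, 'e) pre_digraph \<Rightarrow> nat" where
  "min_valency G = Min (valencies G)"

text \<open>
  The adjacency matrix with respect to an enumeration \<open>vs\<close> of the vertices. Another enumeration
  permutes rows and columns simultaneously, which leaves the spectrum unchanged. The matrix is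
  taken over the reals; being symmetric, it has no non-real eigenvalues, so the real
  \<^const>\<open>spectrum\<close> is the set of all eigenvalues.
\<close>

definition adjacency_mat :: "('v, 'e) pre_digraph \<Rightarrow> 'v list \<Rightarrow> real mat" where
  "adjacency_mat G vs =
     mat (length vs) (length vs) (\<lambda>(i, j). if vs ! i \<rightarrow>\<^bsub>G\<^esub> vs ! j then 1 else 0)"

end

theory Submission
  imports Defs
begin

text \<open>
  The adjacency matrix satisfies \<open>(A - 1)(A + t) = \<alpha>\<alpha>\<^sup>T\<close> with a positive eigenvector \<open>\<alpha>\<close> for \<open>s\<close>.
  Comparing entries, a vertex \<open>u\<close> has valency \<open>t + \<alpha>(u)\<^sup>2\<close>, and two vertices \<open>u, v\<close> have
  \<open>\<alpha>(u)\<alpha>(v) + 1 - t\<close> or \<open>\<alpha>(u)\<alpha>(v)\<close> common neighbours according to whether they are adjacent.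
  If some valency is below \<open>t + 3\<close>, attained at \<open>x\<^sub>0\<close>, then \<open>a = \<alpha>(x\<^sub>0)\<^sup>2\<close> is 1 or 2 and
  \<open>\<alpha> = \<alpha>(x\<^sub>0)r\<close> with integral \<open>r\<close>.
  Estimating the eigenvector equation around a non-neighbour of \<open>x\<^sub>0\<close> shows that a weight
  \<open>r(u) > 1\<close> must satisfy \<open>a r(u) \<ge> t - a\<close>, and counting common neighbours that large vertices of
  distinct weights are adjacent. Hence a small vertex has a neighbourhood of constant weight, and
  every large vertex of another weight is joined to all of that neighbourhood.
  The eigenvector equation at such a vertex, or at a neighbour of \<open>x\<^sub>0\<close>, then fails, so there is at
  most one large weight and at most two valencies.
\<close>

section \<open>Symmetric matrices with three eigenvalues\<close>

locale symmetric_kernel =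
  fixes V :: "'v set" and A :: "'v \<Rightarrow> 'v \<Rightarrow> real"
  assumes finite_V: "finite V"
    and sym: "\<And>u v. u \<in> V \<Longrightarrow> v \<in> V \<Longrightarrow> A u v = A v u"
begin

text \<open>The value type is left open because the same real kernel acts on complex functions,
  where eigenvalues are guaranteed to exist, and on real ones.\<close>

definition op :: "('v \<Rightarrow> 'a::real_field) \<Rightarrow> 'v \<Rightarrow> 'a" where
  "op f u = (\<Sum>w\<in>V. of_real (A u w) * f w)"

definition poly_op :: "'a::real_field poly \<Rightarrow> ('v \<Rightarrow> 'a) \<Rightarrow> 'v \<Rightarrow> 'a" where
  "poly_op p f u = (\<Sum>i\<le>degree p. coeff p i * (op ^^ i) f u)"

text \<open>Bilinear rather than Hermitian: over the complex numbers, norms come from pairing with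
  the conjugate function.\<close>

definition pairing :: "('v \<Rightarrow> 'a::real_field) \<Rightarrow> ('v \<Rightarrow> 'a) \<Rightarrow> 'a" where
  "pairing f g = (\<Sum>u\<in>V. f u * g u)"

lemma op_add: "op (\<lambda>u. f u + g u) u = op f u + op g u"
  by (simp add: op_def distrib_left sum.distrib)

lemma op_diff: "op (\<lambda>u. f u - g u) u = op f u - op g u"
  by (simp add: op_def right_diff_distrib sum_subtractf)

lemma op_scale: "op (\<lambda>u. c * f u) u = c * op f u"
  by (simp add: op_def sum_distrib_left mult_ac)

lemma op_sum: "op (\<lambda>u. \<Sum>i\<in>I. c i * f i u) u = (\<Sum>i\<in>I. c i * op (f i) u)"
proof -
  have "op (\<lambda>u. \<Sum>i\<in>I. c i * f i u) u = (\<Sum>w\<in>V. \<Sum>i\<in>I. c i * (of_real (A u w) * f i w))"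
    by (simp add: op_def sum_distrib_left mult_ac)
  also have "\<dots> = (\<Sum>i\<in>I. c i * op (f i) u)"
    by (subst sum.swap) (simp add: op_def sum_distrib_left)
  finally show ?thesis .
qed

lemma op_cong: "(\<And>u. u \<in> V \<Longrightarrow> f u = g u) \<Longrightarrow> op f u = op g u"
  by (simp add: op_def)

lemma pairing_op: "pairing (op f) g = pairing f (op g)"
proof -
  have "pairing (op f) g = (\<Sum>u\<in>V. \<Sum>w\<in>V. of_real (A u w) * f w * g u)"
    by (simp add: pairing_def op_def sum_distrib_right)
  also have "\<dots> = (\<Sum>w\<in>V. \<Sum>u\<in>V. of_real (A u w) * f w * g u)"
    by (rule sum.swap)
  also have "\<dots> = pairing f (op g)"
    by (auto simp: pairing_def op_def sum_distrib_left sym mult_ac intro!: sum.cong)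
  finally show ?thesis .
qed

lemma poly_op_altdef:
  assumes "degree p \<le> n"
  shows "poly_op p f u = (\<Sum>i\<le>n. coeff p i * (op ^^ i) f u)"
  unfolding poly_op_def using assms
  by (intro sum.mono_neutral_left) (auto simp: coeff_eq_0)

lemma poly_op_add: "poly_op (p + q) f u = poly_op p f u + poly_op q f u"
proof -
  define n where "n = max (degree p) (degree q)"
  have "degree p \<le> n" "degree q \<le> n" "degree (p + q) \<le> n"
    by (auto simp: n_def degree_add_le)
  then show ?thesis
    by (simp add: poly_op_altdef[where n = n] distrib_right sum.distrib)
qed

lemma poly_op_smult: "poly_op (Polynomial.smult c p) f u = c * poly_op p f u"
  by (simp add: poly_op_altdef[where n = "degree p"] degree_smult_le sum_distrib_left mult_ac)

lemma poly_op_0 [simp]: "poly_op 0 f u = 0"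
  by (simp add: poly_op_def)

lemma poly_op_pCons: "poly_op (pCons c p) f u = c * f u + op (poly_op p f) u"
proof -
  have "poly_op (pCons c p) f u = (\<Sum>i\<le>Suc (degree p). coeff (pCons c p) i * (op ^^ i) f u)"
    by (rule poly_op_altdef) (simp add: degree_pCons_le)
  also have "\<dots> = c * f u + (\<Sum>i\<le>degree p. coeff p i * op ((op ^^ i) f) u)"
    by (subst sum.atMost_Suc_shift) simp
  also have "(\<Sum>i\<le>degree p. coeff p i * op ((op ^^ i) f) u) = op (poly_op p f) u"
    unfolding poly_op_def[abs_def] by (simp add: op_sum)
  finally show ?thesis .
qed

lemma poly_op_mult: "poly_op (p * q) f u = poly_op p (poly_op q f) u"
proof (induction p arbitrary: u)
  case (pCons c p)
  have "poly_op (p * q) f = poly_op p (poly_op q f)" using pCons.IH by blast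
  then show ?case by (simp add: poly_op_add poly_op_smult poly_op_pCons)
qed simp

lemma pairing_poly_op: "pairing (poly_op p f) g = pairing f (poly_op p g)"
proof -
  have iter: "pairing ((op ^^ i) f) g = pairing f ((op ^^ i) g)" for i
    by (induction i arbitrary: g) (simp_all add: pairing_op, simp add: funpow_swap1)
  have "pairing (poly_op p f) g = (\<Sum>i\<le>degree p. coeff p i * pairing ((op ^^ i) f) g)"
    unfolding pairing_def poly_op_def sum_distrib_right sum_distrib_left
    by (subst sum.swap) (intro sum.cong refl, simp add: mult_ac)
  also have "\<dots> = (\<Sum>i\<le>degree p. coeff p i * pairing f ((op ^^ i) g))"
    by (simp only: iter)
  also have "\<dots> = pairing f (poly_op p g)"
    unfolding pairing_def poly_op_def sum_distrib_right sum_distrib_left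
    by (subst sum.swap) (intro sum.cong refl, simp add: mult_ac)
  finally show ?thesis .
qed

lemma poly_op_eigen:
  assumes "\<And>u. u \<in> V \<Longrightarrow> op f u = c * f u" "u \<in> V"
  shows "poly_op p f u = poly p c * f u"
  using assms(2)
proof (induction p arbitrary: u)
  case (pCons a p)
  have "op (poly_op p f) u = op (\<lambda>u. poly p c * f u) u"
    by (rule op_cong) (use pCons.IH in blast)
  then show ?case using pCons.prems assms(1) by (simp add: poly_op_pCons op_scale) (simp add: algebra_simps)
qed simp

text \<open>The \<open>card V + 1\<close> iterates of \<open>f\<close> under \<open>op\<close> are
  linearly dependent, and the coefficients of a dependence form \<open>p\<close>.\<close>

lemma annihilating_poly:
  fixes f :: "'v \<Rightarrow> 'a::real_field"
  shows "\<exists>p. p \<noteq> 0 \<and> (\<forall>u\<in>V. poly_op p f u = 0)"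
proof -
  define n where "n = card V"
  obtain h where h: "bij_betw h {0..<n} V"
    using ex_bij_betw_nat_finite[OF finite_V] n_def by blast
  \<comment> \<open>The extra zero row makes the matrix square and visibly singular, so the
    determinant criterion yields the dependence.\<close>
  define M :: "'a mat" where
    "M = mat (Suc n) (Suc n) (\<lambda>(i, j). if i < n then (op ^^ j) f (h i) else 0)"
  have M: "M \<in> carrier_mat (Suc n) (Suc n)" by (simp add: M_def)
  have MT: "M\<^sup>T \<in> carrier_mat (Suc n) (Suc n)" using M by simp
  have "M\<^sup>T *\<^sub>v unit_vec (Suc n) n = 0\<^sub>v (Suc n)"
    by (rule eq_vecI) (auto simp: M_def)
  moreover have "unit_vec (Suc n) n \<noteq> (0\<^sub>v (Suc n) :: 'a vec)"
    using unit_vec_nonzero by blast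
  ultimately have "det (M\<^sup>T) = 0"
    unfolding det_0_iff_vec_prod_zero_field[OF MT]
    by (intro exI[of _ "unit_vec (Suc n) n"] conjI unit_vec_carrier)
  then have "det M = 0" using det_transpose[OF M] by simp
  then obtain c where c: "c \<in> carrier_vec (Suc n)" "c \<noteq> 0\<^sub>v (Suc n)" "M *\<^sub>v c = 0\<^sub>v (Suc n)"
    using det_0_iff_vec_prod_zero_field[OF M] by blast
  define p where "p = (\<Sum>i\<le>n. monom (c $ i) i)"
  have cp: "coeff p i = (if i \<le> n then c $ i else 0)" for i
    by (simp add: p_def coeff_sum)
  have "p \<noteq> 0"
  proof
    assume "p = 0"
    then have "c $ i = 0" if "i < Suc n" for i using cp[of i] that by simp
    then show False using c by (auto simp: vec_eq_iff)
  qed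
  moreover have "poly_op p f u = 0" if u: "u \<in> V" for u
  proof -
    obtain i where i: "i < n" "u = h i" using h u by (auto simp: bij_betw_def)
    have "degree p \<le> n" using cp by (intro degree_le) auto
    then have "poly_op p f u = (\<Sum>j\<le>n. c $ j * (op ^^ j) f u)"
      using cp by (simp add: poly_op_altdef)
    also have "\<dots> = (\<Sum>j\<in>{0..<Suc n}. (op ^^ j) f u * c $ j)"
      by (rule sum.cong) (auto simp: mult.commute)
    also have "\<dots> = (M *\<^sub>v c) $ i"
      using i c(1) by (simp add: M_def scalar_prod_def)
    finally show ?thesis using c(3) i by simp
  qed
  ultimately show ?thesis by blast
qed

text \<open>Self-adjointness gives \<open>c * I = cnj c * I\<close> for the positive squared norm
  \<open>I\<close>, so \<open>c\<close> is real; real and imaginary part of \<open>f\<close> then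
  satisfy the same equation, and one of them is nonzero.\<close>

lemma complex_eigenvalue_real:
  fixes f :: "'v \<Rightarrow> complex"
  assumes nz: "u0 \<in> V" "f u0 \<noteq> 0" and eig: "\<And>u. u \<in> V \<Longrightarrow> op f u = c * f u"
  obtains \<theta> g where "c = of_real \<theta>" "\<exists>u\<in>V. g u \<noteq> (0::real)" "\<And>u. u \<in> V \<Longrightarrow> op g u = \<theta> * g u"
proof -
  have cnj_op: "op (\<lambda>u. cnj (f u)) u = cnj (op f u)" for u
    by (simp add: op_def cnj_sum)
  define I where "I = (\<Sum>u\<in>V. (cmod (f u))\<^sup>2)"
  have I: "pairing f (\<lambda>u. cnj (f u)) = of_real I"
    by (simp add: pairing_def I_def complex_norm_square del: of_real_power)
  have "0 < (cmod (f u0))\<^sup>2" using nz by simp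
  then have "0 < I" unfolding I_def using finite_V nz by (intro sum_pos2[of V u0]) auto
  have "c * of_real I = pairing (op f) (\<lambda>u. cnj (f u))"
    unfolding I[symmetric] using eig by (simp add: pairing_def sum_distrib_left mult_ac)
  also have "\<dots> = pairing f (op (\<lambda>u. cnj (f u)))" by (rule pairing_op)
  also have "\<dots> = cnj c * of_real I"
    unfolding I[symmetric] using eig by (simp add: pairing_def cnj_op sum_distrib_left mult_ac)
  finally have "c = cnj c" using \<open>0 < I\<close> by simp
  then have c: "c = of_real (Re c)" by (simp add: complex_eq_iff)
  have eig': "op f u = of_real (Re c) * f u" if "u \<in> V" for u
    using eig[OF that] c by metis
  have re: "op (\<lambda>u. Re (f u)) u = Re c * Re (f u)" if "u \<in> V" for u
  proof -
    have "op (\<lambda>u. Re (f u)) u = Re (op f u)" by (simp add: op_def Re_sum)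
    then show ?thesis using eig'[OF that] by simp
  qed
  have im: "op (\<lambda>u. Im (f u)) u = Re c * Im (f u)" if "u \<in> V" for u
  proof -
    have "op (\<lambda>u. Im (f u)) u = Im (op f u)" by (simp add: op_def Im_sum)
    then show ?thesis using eig'[OF that] by simp
  qed
  show ?thesis
  proof (cases "Re (f u0) = 0")
    case True
    then have "Im (f u0) \<noteq> 0" using nz by (simp add: complex_eq_iff)
    then show ?thesis using that[OF c _ im] nz by blast
  next
    case False
    then show ?thesis using that[OF c _ re] nz by blast
  qed
qed

text \<open>
  A minimal polynomial annihilating \<open>q(A)g \<noteq> 0\<close> would have a root \<open>\<theta>\<close>, hence an eigenvector
  \<open>w = q(A)w'\<close> with eigenvalue \<open>\<theta>\<close>; but \<open>q(A)w = 0\<close>, so \<open>\<langle>w, w\<rangle> = \<langle>w', q(A)w\<rangle> = 0\<close>.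
\<close>

lemma poly_op_vanishes:
  fixes q :: "complex poly"
  assumes roots: "\<And>\<theta> f. \<exists>u\<in>V. f u \<noteq> (0::real) \<Longrightarrow> (\<And>u. u \<in> V \<Longrightarrow> op f u = \<theta> * f u) \<Longrightarrow> poly q (of_real \<theta>) = 0"
    and u: "u \<in> V"
  shows "poly_op q g u = 0"
proof (rule ccontr)
  assume nz: "poly_op q g u \<noteq> 0"
  define v where "v = poly_op q g"
  define P where "P p \<longleftrightarrow> p \<noteq> 0 \<and> (\<forall>u\<in>V. poly_op p v u = 0)" for p
  obtain p where p: "P p" "\<And>p'. P p' \<Longrightarrow> degree p \<le> degree p'"
    using annihilating_poly[of v] exists_least_iff[of "\<lambda>n. \<exists>p. P p \<and> degree p = n"]
    by (metis P_def not_le)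
  have "degree p \<noteq> 0"
  proof
    assume "degree p = 0"
    then obtain c where "p = [:c:]" by (rule degree_eq_zeroE)
    then show False using p(1) nz u by (auto simp: P_def v_def poly_op_pCons op_def)
  qed
  then obtain c where "poly p c = 0"
    using fundamental_theorem_of_algebra[of p] constant_degree[of p] by auto
  then obtain p' where pp': "p = [:- c, 1:] * p'" by (auto simp: poly_eq_0_iff_dvd)
  have "p' \<noteq> 0" using p(1) pp' by (auto simp: P_def)
  have "degree p = Suc (degree p')" unfolding pp' using \<open>p' \<noteq> 0\<close> by (subst degree_mult_eq) auto
  then have "\<not> P p'" using p(2)[of p'] by auto
  define w where "w = poly_op p' v"
  obtain u0 where u0: "u0 \<in> V" "w u0 \<noteq> 0"
    using \<open>\<not> P p'\<close> \<open>p' \<noteq> 0\<close> by (auto simp: P_def w_def)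
  have eig: "op w u = c * w u" if "u \<in> V" for u
  proof -
    have "poly_op p v u = 0" using p(1) that by (simp add: P_def)
    then show ?thesis
      unfolding pp' poly_op_mult w_def[symmetric] by (simp add: poly_op_pCons op_def)
  qed
  have cnj_eig: "op (\<lambda>u. cnj (w u)) u = cnj c * cnj (w u)" if "u \<in> V" for u
  proof -
    have "op (\<lambda>u. cnj (w u)) u = cnj (op w u)" by (simp add: op_def cnj_sum)
    then show ?thesis using eig[OF that] by simp
  qed
  obtain \<theta> h where h: "c = of_real \<theta>" "\<exists>u\<in>V. h u \<noteq> (0::real)" "\<And>u. u \<in> V \<Longrightarrow> op h u = \<theta> * h u"
    using complex_eigenvalue_real[OF u0 eig] by blast
  have qc: "poly q (cnj c) = 0" using roots[OF h(2,3)] h(1) by simp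
  have "w = poly_op (p' * q) g" by (simp add: w_def v_def poly_op_mult fun_eq_iff)
  \<comment> \<open>Polynomials in one operator commute, so \<open>q\<close> can be moved outermost
    and then across the pairing.\<close>
  then have "w = poly_op (q * p') g" by (simp only: mult.commute)
  then have "w = poly_op q (poly_op p' g)" by (simp add: poly_op_mult fun_eq_iff)
  then have "pairing w (\<lambda>u. cnj (w u)) = pairing (poly_op p' g) (poly_op q (\<lambda>u. cnj (w u)))"
    using pairing_poly_op by metis
  also have "\<dots> = 0"
    using poly_op_eigen[OF cnj_eig] qc by (simp add: pairing_def)
  finally have "(\<Sum>u\<in>V. of_real ((cmod (w u))\<^sup>2)) = (0::complex)"
    by (simp add: pairing_def complex_norm_square del: of_real_power)
  then have "(\<Sum>u\<in>V. (cmod (w u))\<^sup>2) = 0"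
    by (simp only: of_real_sum[symmetric] of_real_eq_0_iff)
  then show False using u0 finite_V by (simp add: sum_nonneg_eq_0_iff)
qed

lemma op_of_real: "op (\<lambda>u. of_real (f u)) u = (of_real (op f u) :: 'a::real_field)"
  by (simp add: op_def)

end

section \<open>Perron-Frobenius theory and the rank-one identity\<close>

locale three_eigenvalue_kernel = symmetric_kernel V A
  for V :: "'v set" and A :: "'v \<Rightarrow> 'v \<Rightarrow> real" +
  fixes s t :: real
  assumes nonneg: "\<And>u v. u \<in> V \<Longrightarrow> v \<in> V \<Longrightarrow> 0 \<le> A u v"
    and irreducible: "\<And>U. U \<subseteq> V \<Longrightarrow> U \<noteq> {} \<Longrightarrow>
          (\<And>u w. u \<in> U \<Longrightarrow> w \<in> V \<Longrightarrow> A u w \<noteq> 0 \<Longrightarrow> w \<in> U) \<Longrightarrow> U = V"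
    and eigenvalues: "\<And>\<theta> f. \<exists>u\<in>V. f u \<noteq> (0::real) \<Longrightarrow> (\<And>u. u \<in> V \<Longrightarrow> op f u = \<theta> * f u) \<Longrightarrow> \<theta> \<in> {s, 1, - t}"
    and ex_eigen: "\<exists>f. (\<exists>u\<in>V. f u \<noteq> (0::real)) \<and> (\<forall>u\<in>V. op f u = s * f u)"
    and s_gt: "1 < s" and t_ge: "1 \<le> t"
begin

text \<open>This is \<open>(A - 1)(A + t)\<close> applied to \<open>f\<close>; it kills eigenvectors
  for \<open>1\<close> and \<open>-t\<close>.\<close>

definition proj :: "('v \<Rightarrow> real) \<Rightarrow> 'v \<Rightarrow> real" where
  "proj f u = op (op f) u + (t - 1) * op f u - t * f u"

text \<open>Every eigenvalue is a root of \<open>(x - s)(x - 1)(x + t)\<close>, so this cubic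
  annihilates all functions; the argument runs over the complex numbers and is read back over the
  reals.\<close>

lemma op_proj: "u \<in> V \<Longrightarrow> op (proj f) u = s * proj f u"
proof -
  assume u: "u \<in> V"
  define q :: "complex poly" where "q = [:- of_real s, 1:] * ([:-1, 1:] * [:of_real t, 1:])"
  have one: "poly_op [:1:] h = h" for h :: "'v \<Rightarrow> complex"
    by (simp add: fun_eq_iff poly_op_pCons op_def)
  have lin: "poly_op [:c, 1:] h = (\<lambda>u. c * h u + op h u)" for c :: complex and h
    by (simp add: fun_eq_iff poly_op_pCons[of c] one)
  have "poly q (of_real \<theta>) = 0" if "\<exists>u\<in>V. f u \<noteq> (0::real)" "\<And>u. u \<in> V \<Longrightarrow> op f u = \<theta> * f u" for \<theta> f
    using eigenvalues[OF that] by (auto simp: q_def algebra_simps)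
  then have "poly_op q (\<lambda>u. of_real (f u)) u = 0"
    using poly_op_vanishes[of q] u by blast
  moreover have "poly_op q (\<lambda>u. of_real (f u)) u = of_real (op (proj f) u - s * proj f u)"
    unfolding q_def poly_op_mult lin proj_def[abs_def]
    by (simp add: op_add op_diff op_scale op_of_real algebra_simps)
  ultimately have "complex_of_real (op (proj f) u - s * proj f u) = 0" by (simp only:)
  then show ?thesis by (simp only: of_real_eq_0_iff)
qed

lemma proj_eigen:
  assumes "\<And>u. u \<in> V \<Longrightarrow> op f u = s * f u" "u \<in> V"
  shows "proj f u = (s - 1) * (s + t) * f u"
proof -
  have "op (op f) u = op (\<lambda>u. s * f u) u" by (rule op_cong) (use assms in blast)
  then show ?thesis using assms by (simp add: proj_def op_scale algebra_simps)
qed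

lemma pairing_proj: "pairing (proj f) g = pairing f (proj g)"
proof -
  have "pairing (proj f) g = pairing (op (op f)) g + (t - 1) * pairing (op f) g - t * pairing f g"
    by (simp add: pairing_def proj_def sum.distrib sum_subtractf sum_distrib_left algebra_simps)
  also have "\<dots> = pairing f (op (op g)) + (t - 1) * pairing f (op g) - t * pairing f g"
    by (simp add: pairing_op)
  also have "\<dots> = pairing f (proj g)"
    by (simp add: pairing_def proj_def sum.distrib sum_subtractf sum_distrib_left algebra_simps)
  finally show ?thesis .
qed

text \<open>
  \<open>(A - 1)(A + t)\<close> is \<open>(s - 1)(s + t)\<close> times an orthogonal projection \<open>P\<close> onto the eigenspace
  of \<open>s\<close>. Pointwise \<open>P f \<ge> f \<ge> 0\<close>, so \<open>\<langle>P f, P f\<rangle> = \<langle>P f, f\<rangle> \<ge> \<langle>f, f\<rangle>\<close> and therefore \<open>P f = f\<close>.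
\<close>

lemma subharmonic_eigen:
  assumes pos: "\<And>u. u \<in> V \<Longrightarrow> 0 \<le> f u" and sub: "\<And>u. u \<in> V \<Longrightarrow> s * f u \<le> op f u"
    and u: "u \<in> V"
  shows "op f u = s * f u"
proof -
  define k where "k = (s - 1) * (s + t)"
  have k: "0 < k" using s_gt t_ge by (simp add: k_def)
  have ge: "k * f v \<le> proj f v" if v: "v \<in> V" for v
  proof -
    have "s * (s * f v) \<le> s * op f v" using sub[OF v] s_gt by simp
    also have "\<dots> = op (\<lambda>u. s * f u) v" by (simp add: op_scale)
    also have "\<dots> \<le> op (op f) v"
      unfolding op_def[of _ v] using sub nonneg v by (intro sum_mono mult_left_mono) auto
    finally have "s * (s * f v) \<le> op (op f) v" .
    moreover have "(t - 1) * (s * f v) \<le> (t - 1) * op f v"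
      using sub[OF v] t_ge by (intro mult_left_mono) auto
    ultimately show ?thesis by (simp add: proj_def k_def algebra_simps)
  qed
  have "pairing (proj f) (proj f) = pairing f (proj (proj f))" by (rule pairing_proj)
  also have "\<dots> = k * pairing f (proj f)"
    using proj_eigen[OF op_proj] by (simp add: pairing_def k_def sum_distrib_left mult_ac)
  finally have pp: "pairing (proj f) (proj f) = k * pairing f (proj f)" .
  have "k * pairing f f \<le> pairing f (proj f)"
    unfolding pairing_def sum_distrib_left
  proof (rule sum_mono)
    fix v assume "v \<in> V"
    then show "k * (f v * f v) \<le> f v * proj f v"
      using mult_left_mono[OF ge pos] by (simp add: mult.left_commute)
  qed
  \<comment> \<open>By \<open>pp\<close> this square equals
    \<open>k * (k * pairing f f - pairing f (proj f))\<close>, which the previous inequality makes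
    nonpositive.\<close>
  moreover have "(\<Sum>v\<in>V. (proj f v - k * f v)\<^sup>2)
      = pairing (proj f) (proj f) - 2 * k * pairing f (proj f) + k * (k * pairing f f)"
    by (simp add: pairing_def power2_eq_square sum.distrib sum_subtractf sum_distrib_left algebra_simps)
  moreover have "0 \<le> (\<Sum>v\<in>V. (proj f v - k * f v)\<^sup>2)" by (simp add: sum_nonneg)
  ultimately have "(\<Sum>v\<in>V. (proj f v - k * f v)\<^sup>2) = 0"
    using pp k mult_left_mono[of "k * pairing f f" "pairing f (proj f)" k] by linarith
  then have eq: "proj f v = k * f v" if "v \<in> V" for v
    using finite_V that by (simp add: sum_nonneg_eq_0_iff)
  have "k * op f u = op (proj f) u"
    unfolding op_scale[symmetric] by (rule op_cong) (simp add: eq)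
  also have "\<dots> = k * (s * f u)" using op_proj[OF u] eq[OF u] by simp
  finally show ?thesis using k by simp
qed

text \<open>The triangle inequality makes the absolute value satisfy the hypothesis of
  \<open>subharmonic_eigen\<close>.\<close>

lemma abs_eigen:
  fixes f :: "'v \<Rightarrow> real"
  assumes eig: "\<And>u. u \<in> V \<Longrightarrow> op f u = s * f u" and u: "u \<in> V"
  shows "op (\<lambda>u. \<bar>f u\<bar>) u = s * \<bar>f u\<bar>"
proof (rule subharmonic_eigen[OF _ _ u])
  fix v assume v: "v \<in> V"
  have "s * \<bar>f v\<bar> = \<bar>op f v\<bar>" using eig[OF v] s_gt by (simp add: abs_mult)
  also have "\<dots> \<le> (\<Sum>w\<in>V. \<bar>of_real (A v w) * f w\<bar>)" unfolding op_def by (rule sum_abs)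
  also have "\<dots> = op (\<lambda>u. \<bar>f u\<bar>) v"
    unfolding op_def using nonneg v by (intro sum.cong refl) (simp add: abs_mult)
  finally show "s * \<bar>f v\<bar> \<le> op (\<lambda>u. \<bar>f u\<bar>) v" .
qed simp

text \<open>At a zero of \<open>f\<close> a sum of nonnegative terms
  \<open>A v w * \<bar>f w\<bar>\<close> vanishes, so the zero set is closed under neighbours. Hence
  the eigenspace of \<open>s\<close> has dimension at most one.\<close>

lemma eigen_vanishing:
  assumes eig: "\<And>u. u \<in> V \<Longrightarrow> op f u = s * f u" and z: "z \<in> V" "f z = (0::real)" and u: "u \<in> V"
  shows "f u = 0"
proof -
  have "{v \<in> V. f v = 0} = V"
  proof (rule irreducible)
    fix v w assume v: "v \<in> {v \<in> V. f v = 0}" and w: "w \<in> V" "A v w \<noteq> 0"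
    then have "(\<Sum>w\<in>V. A v w * \<bar>f w\<bar>) = 0" using abs_eigen[OF eig, of v] by (simp add: op_def)
    then have "A v w * \<bar>f w\<bar> = 0"
      using finite_V nonneg v w by (subst (asm) sum_nonneg_eq_0_iff) auto
    then show "w \<in> {v \<in> V. f v = 0}" using w by simp
  qed (use z in auto)
  then show ?thesis using u by blast
qed

lemma ex_positive_eigen:
  "\<exists>f. (\<forall>u\<in>V. (0::real) < f u) \<and> (\<forall>u\<in>V. op f u = s * f u)"
proof -
  obtain f :: "'v \<Rightarrow> real" where f: "\<exists>u\<in>V. f u \<noteq> 0" "\<And>u. u \<in> V \<Longrightarrow> op f u = s * f u"
    using ex_eigen by blast
  have "op (\<lambda>u. \<bar>f u\<bar>) v = s * \<bar>f v\<bar>" if "v \<in> V" for v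
    using abs_eigen f(2) that by blast
  moreover have "0 < \<bar>f u\<bar>" if "u \<in> V" for u
    using eigen_vanishing[of f u] f that by fastforce
  ultimately show ?thesis by (intro exI[of _ "\<lambda>u. \<bar>f u\<bar>"]) blast
qed

text \<open>Each column of \<open>(A - 1)(A + t)\<close> is a multiple of the positive eigenvector
  \<open>f\<close>, so by symmetry the entries are \<open>c * (f u * f v)\<close>; a positive
  \<open>c\<close> can be absorbed into \<open>\<alpha>\<close>.\<close>

theorem ex_rank_one:
  "\<exists>\<alpha>. (\<forall>u\<in>V. 0 < \<alpha> u) \<and> (\<forall>u\<in>V. (\<Sum>w\<in>V. A u w * \<alpha> w) = s * \<alpha> u) \<and>
    (\<forall>u\<in>V. \<forall>v\<in>V. (\<Sum>w\<in>V. A u w * A w v) + (t - 1) * A u v - t * of_bool (u = v) = \<alpha> u * \<alpha> v)"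
proof -
  obtain f :: "'v \<Rightarrow> real" where f: "\<And>u. u \<in> V \<Longrightarrow> 0 < f u" "\<And>u. u \<in> V \<Longrightarrow> op f u = s * f u"
    using ex_positive_eigen by blast
  obtain z where z: "z \<in> V" using ex_eigen by blast
  define B where "B u v = (\<Sum>w\<in>V. A u w * A w v) + (t - 1) * A u v - t * of_bool (u = v)" for u v
  have B_sym: "B u v = B v u" if "u \<in> V" "v \<in> V" for u v
    unfolding B_def using that sym by (auto intro!: sum.cong simp: mult.commute)
  have B_proj: "B u v = proj (\<lambda>w. of_bool (w = v)) u" if "v \<in> V" for u v
  proof -
    have "op (\<lambda>w. of_bool (w = v)) x = A x v" for x
      using that finite_V by (simp add: op_def of_bool_def if_distrib cong: if_cong)
    then show ?thesis by (simp add: B_def proj_def[of _ u] op_def[of _ u])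
  qed
  have rank1: "B u v = f u * (B z v / f z)" if "u \<in> V" "v \<in> V" for u v
  proof -
    \<comment> \<open>Chosen to vanish at \<open>z\<close>, so \<open>eigen_vanishing\<close> makes
      it vanish on all of \<open>V\<close>.\<close>
    define g where "g u = f z * B u v - B z v * f u" for u
    have "op g w = s * g w" if "w \<in> V" for w
    proof -
      have "op (\<lambda>u. B u v) w = s * B w v" using op_proj[OF that] B_proj[OF \<open>v \<in> V\<close>] by simp
      then show ?thesis using f(2)[OF that] by (simp add: g_def[abs_def] op_diff op_scale) (simp add: algebra_simps)
    qed
    then have "g u = 0" using eigen_vanishing[of g z u] z that by (simp add: g_def)
    then show ?thesis using f(1)[OF z] by (simp add: g_def field_simps)
  qed
  define c where "c = B z z / (f z * f z)"
  have B: "B u v = c * (f u * f v)" if "u \<in> V" "v \<in> V" for u v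
  proof -
    have "B z v = f v * (B z z / f z)" using rank1[OF that(2) z] B_sym[OF z that(2)] by simp
    then show ?thesis using rank1[OF that] by (simp add: c_def)
  qed
  \<comment> \<open>Evaluating the matrix on \<open>f\<close> at \<open>z\<close> in two ways
    determines \<open>c\<close> and shows that it is positive.\<close>
  have "c * f z * (\<Sum>v\<in>V. f v * f v) = (\<Sum>v\<in>V. B z v * f v)"
    using B z by (simp add: sum_distrib_left mult_ac)
  also have "\<dots> = proj f z"
  proof -
    have "(\<Sum>v\<in>V. of_bool (z = v) * f v) = (\<Sum>v\<in>V. if z = v then f v else 0)"
      by (rule sum.cong) auto
    then have delta: "(\<Sum>v\<in>V. of_bool (z = v) * f v) = f z" using finite_V z by simp
    have "(\<Sum>v\<in>V. B z v * f v) = (\<Sum>v\<in>V. (\<Sum>w\<in>V. A z w * A w v) * f v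
        + (t - 1) * (A z v * f v) - t * (of_bool (z = v) * f v))"
      by (rule sum.cong) (simp_all add: B_def algebra_simps)
    also have "\<dots> = (\<Sum>v\<in>V. (\<Sum>w\<in>V. A z w * A w v) * f v) + (t - 1) * op f z - t * f z"
      by (simp only: sum.distrib sum_subtractf sum_distrib_left[symmetric] delta) (simp add: op_def)
    also have "(\<Sum>v\<in>V. (\<Sum>w\<in>V. A z w * A w v) * f v) = (\<Sum>v\<in>V. \<Sum>w\<in>V. A z w * (A w v * f v))"
      by (simp add: sum_distrib_right mult.assoc)
    also have "\<dots> = op (op f) z"
      by (subst sum.swap) (simp add: op_def sum_distrib_left)
    finally show ?thesis by (simp add: proj_def)
  qed
  also have "\<dots> = (s - 1) * (s + t) * f z" using proj_eigen[OF f(2) z] .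
  finally have "c * (\<Sum>v\<in>V. f v * f v) = (s - 1) * (s + t)" using f(1)[OF z] by simp
  moreover have "0 < (s - 1) * (s + t)" using s_gt t_ge by simp
  moreover have "0 \<le> (\<Sum>v\<in>V. f v * f v)" by (simp add: sum_nonneg)
  ultimately have c: "0 < c" by (metis mult_nonpos_nonneg not_le)
  define \<alpha> where "\<alpha> u = sqrt c * f u" for u
  have "\<alpha> u * \<alpha> v = c * (f u * f v)" for u v
    using c by (simp add: \<alpha>_def algebra_simps) 
  moreover have "(\<Sum>w\<in>V. A u w * \<alpha> w) = s * \<alpha> u" if "u \<in> V" for u
    using f(2)[OF that] by (simp add: \<alpha>_def op_def sum_distrib_left[symmetric] mult.left_commute)
  moreover have "0 < \<alpha> u" if "u \<in> V" for u using f(1)[OF that] c by (simp add: \<alpha>_def)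
  ultimately show ?thesis using B unfolding B_def by (intro exI[of _ \<alpha>]) simp
qed

end

section \<open>Graphs with integral Perron weights\<close>

text \<open>
  If \<open>(A - 1)(A + t) = \<alpha>\<alpha>\<^sup>T\<close>, then \<open>r\<close> is the vector \<open>\<alpha>\<close> divided by its value at a vertex \<open>x\<^sub>0\<close>
  and \<open>a = \<alpha>(x\<^sub>0)\<^sup>2\<close>. Vertices of weight 1 are called small below, all others large.
\<close>

locale scaled_graph =
  fixes V :: "'v set" and N :: "'v \<Rightarrow> 'v set" and r :: "'v \<Rightarrow> int" and t a s :: int
  assumes fin: "finite V"
    and nb_sub: "\<And>u. N u \<subseteq> V"
    and nb_sym: "\<And>u v. u \<in> V \<Longrightarrow> v \<in> N u \<Longrightarrow> u \<in> N v"
    and nb_irrefl: "\<And>u. u \<notin> N u"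
    and degree: "\<And>u. u \<in> V \<Longrightarrow> int (card (N u)) = t + a * r u * r u"
    and common_adj: "\<And>u v. u \<in> V \<Longrightarrow> v \<in> N u \<Longrightarrow> int (card (N u \<inter> N v)) = a * r u * r v - t + 1"
    and common_nonadj: "\<And>u v. u \<in> V \<Longrightarrow> v \<in> V \<Longrightarrow> u \<noteq> v \<Longrightarrow> v \<notin> N u
          \<Longrightarrow> int (card (N u \<inter> N v)) = a * r u * r v"
    and eigen: "\<And>u. u \<in> V \<Longrightarrow> (\<Sum>v\<in>N u. r v) = s * r u"
    and r_pos: "\<And>u. u \<in> V \<Longrightarrow> 1 \<le> r u"
    and t_ge: "11 \<le> t"
    and a_cases: "a = 1 \<or> a = 2"
    and not_cone: "\<And>u. u \<in> V \<Longrightarrow> \<exists>v \<in> V. v \<noteq> u \<and> v \<notin> N u"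
begin

lemma nb_V: "v \<in> N u \<Longrightarrow> v \<in> V"
  using nb_sub by blast

lemma fin_nb [simp]: "finite (N u)"
  using fin nb_sub finite_subset by blast

lemma card_diff: "int (card (N u - N v)) = int (card (N u)) - int (card (N u \<inter> N v))"
  using card_Int_Diff[of "N u" "N v"] by simp

section \<open>Neighbours and non-neighbours of a small vertex\<close>

lemma degree_small: "x \<in> V \<Longrightarrow> r x = 1 \<Longrightarrow> int (card (N x)) = t + a"
  using degree by simp

text \<open>A number of common neighbours is nonnegative, which bounds \<open>r y\<close> below; in
  particular small vertices are never adjacent.\<close>

lemma small_nb:
  assumes "x \<in> V" "r x = 1" "y \<in> N x"
  shows "int (card (N x \<inter> N y)) = a * r y - t + 1" "t - 1 \<le> a * r y" "2 \<le> r y"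
proof -
  show c: "int (card (N x \<inter> N y)) = a * r y - t + 1"
    using common_adj[of x y] assms by simp
  show "t - 1 \<le> a * r y" using c by linarith
  then show "2 \<le> r y" using a_cases t_ge by auto
qed

lemma small_non_nb:
  assumes "x \<in> V" "r x = 1" "z \<in> V" "z \<noteq> x" "z \<notin> N x"
  shows "int (card (N x \<inter> N z)) = a * r z" "a * r z \<le> t + a"
proof -
  show c: "int (card (N x \<inter> N z)) = a * r z"
    using common_nonadj[of x z] assms by simp
  have "card (N x \<inter> N z) \<le> card (N x)" by (rule card_mono) auto
  then show "a * r z \<le> t + a" using c degree_small[OF assms(1,2)] by linarith
qed

lemma small_sum:
  assumes "x \<in> V" "r x = 1"
  shows "(\<Sum>v\<in>N x. r v) = s" "(t + a) * (t - 1) \<le> a * s"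
proof -
  show S: "(\<Sum>v\<in>N x. r v) = s" using eigen assms by simp
  have "(\<Sum>v\<in>N x. t - 1) \<le> (\<Sum>v\<in>N x. a * r v)"
    by (rule sum_mono) (use small_nb[OF assms] in blast)
  then show "(t + a) * (t - 1) \<le> a * s"
    using degree_small[OF assms] S by (simp add: sum_distrib_left[symmetric])
qed

text \<open>Subtracting the eigenvector equations at \<open>x\<close> and \<open>z\<close> cancels
  the common neighbours. The rest is bounded by \<open>small_non_nb\<close> on
  \<open>N z - N x\<close> and by \<open>small_nb\<close> on \<open>N x - N z\<close>.\<close>

lemma large_non_nb:
  assumes x: "x \<in> V" "r x = 1" and z: "z \<in> V" "z \<noteq> x" "z \<notin> N x" "2 \<le> r z"
  shows "t - 1 - a \<le> a * r z" and "a * s \<le> (t + a) * (t + 2 * a)"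
proof -
  define R where "R = r z"
  have c: "int (card (N x \<inter> N z)) = a * R" "a * R \<le> t + a"
    using small_non_nb[OF x z(1-3)] R_def by auto
  have xz: "x \<notin> N z" using nb_sym[of z x] z x by blast
  have "(\<Sum>v\<in>N z - N x. a * r v) \<le> (\<Sum>v\<in>N z - N x. t + a)"
    by (rule sum_mono) (use small_non_nb(2)[OF x] nb_V xz in blast)
  also have "\<dots> = (t + a) * (t + a * R * R - a * R)"
    using card_diff[of z x] degree[OF z(1)] c by (simp add: Int_commute R_def)
  finally have out: "(\<Sum>v\<in>N z - N x. a * r v) \<le> (t + a) * (t + a * R * R - a * R)" .
  have "(\<Sum>v\<in>N x - N z. t - 1) \<le> (\<Sum>v\<in>N x - N z. a * r v)"
    by (rule sum_mono) (use small_nb[OF x] in blast)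
  then have rest: "(t + a - a * R) * (t - 1) \<le> (\<Sum>v\<in>N x - N z. a * r v)"
    using card_diff[of x z] degree_small[OF x] c by simp
  have "a * s = (\<Sum>v\<in>N x. a * r v)"
    using small_sum(1)[OF x] by (simp add: sum_distrib_left[symmetric])
  also have "\<dots> = (\<Sum>v\<in>N x \<inter> N z. a * r v) + (\<Sum>v\<in>N x - N z. a * r v)"
    by (rule sum.Int_Diff) simp
  finally have sx: "a * s = (\<Sum>v\<in>N x \<inter> N z. a * r v) + (\<Sum>v\<in>N x - N z. a * r v)" .
  have "a * s * R = (\<Sum>v\<in>N z. a * r v)"
    using eigen[OF z(1)] by (simp add: sum_distrib_left[symmetric] R_def)
  also have "\<dots> = (\<Sum>v\<in>N x \<inter> N z. a * r v) + (\<Sum>v\<in>N z - N x. a * r v)"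
    using sum.Int_Diff[of "N z" "\<lambda>v. a * r v" "N x"] by (simp add: Int_commute)
  finally have sz: "a * s * R = (\<Sum>v\<in>N x \<inter> N z. a * r v) + (\<Sum>v\<in>N z - N x. a * r v)" .
  have main: "a * s * (R - 1) \<le> (t + a) * (t + a * R * R - a * R) - (t + a - a * R) * (t - 1)"
    using sx sz out rest by (simp add: right_diff_distrib)
  have R2: "2 \<le> R" using z R_def by simp
  have "(t + a) * (t - 1) * (R - 1) \<le> a * s * (R - 1)"
    using small_sum(2)[OF x] R2 by (intro mult_right_mono) auto
  with main have E: "t * (t - 1) * R \<le> (t + a) * (t + a * R * R - a * R)"
    by (simp add: algebra_simps)
  show "t - 1 - a \<le> a * r z"
  proof (rule ccontr)
    assume "\<not> ?thesis"
    then have ub: "a * R \<le> t - 2 - a" by (simp add: R_def)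
    from a_cases show False
    proof
      assume a: "a = 1"
      \<comment> \<open>\<open>R\<close> lies between \<open>2\<close> and the endpoint given by
        \<open>ub\<close>; the product bounds the square of \<open>R\<close> by its chord, leaving
        an inequality linear in \<open>R\<close>.\<close>
      have "0 \<le> (t + 1) * ((R - 2) * (t - 3 - R))" using ub R2 t_ge a by simp
      moreover have "0 \<le> (t + 1) * (t - 6)" using t_ge by simp
      ultimately show False using E a R2 by (simp add: algebra_simps)
    next
      assume a: "a = 2"
      have "0 \<le> (t + 2) * ((R - 2) * (t - 4 - 2 * R))" using ub R2 t_ge a by simp
      moreover have "0 \<le> (t - 4) * (t - 4 - 2 * R)" using ub t_ge a by simp
      moreover have "0 \<le> (t - 11) * (t + 7)" using t_ge by simp
      ultimately show False using E a t_ge by (simp add: algebra_simps)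
    qed
  qed
  have "0 \<le> (t + a - a * R) * (t - 1)" using c t_ge by simp
  \<comment> \<open>This product is exactly the gap between
    \<open>(t + a) * (t + 2 * a) * (R - 1)\<close> and the first term on the right of
    \<open>main\<close>.\<close>
  moreover have "0 \<le> (t + a) * ((t + a - a * R) * (R - 2))" using c R2 t_ge a_cases by auto
  ultimately have "a * s * (R - 1) \<le> (t + a) * (t + 2 * a) * (R - 1)"
    using main a_cases by (auto simp: algebra_simps)
  then show "a * s \<le> (t + a) * (t + 2 * a)"
    using R2 by (simp add: mult_le_cancel_right)
qed

end

section \<open>Large vertices: range of weights and adjacency\<close>

locale scaled_graph_small = scaled_graph +
  fixes x0
  assumes x0: "x0 \<in> V" "r x0 = 1"
begin

text \<open>\<open>large_non_nb\<close> asks for a large non-neighbour of a small vertex. If the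
  non-neighbour \<open>z\<close> of \<open>x0\<close> is itself small, it has neighbours outside
  \<open>N x0\<close>, and these are large.\<close>

lemma s_upper: "a * s \<le> (t + a) * (t + 2 * a)"
proof -
  obtain z where z: "z \<in> V" "z \<noteq> x0" "z \<notin> N x0" using not_cone x0 by blast
  show ?thesis
  proof (cases "2 \<le> r z")
    case True
    then show ?thesis using large_non_nb(2)[OF x0 z] by blast
  next
    case False
    then have z1: "r z = 1" using r_pos[OF z(1)] by simp
    have "int (card (N x0 \<inter> N z)) = a" using small_non_nb(1)[OF x0 z] z1 by simp
    then have "int (card (N z - N x0)) = t"
      using card_diff[of z x0] degree_small[OF z(1) z1] by (simp add: Int_commute)
    then have "N z - N x0 \<noteq> {}" using t_ge by force
    then obtain y where y: "y \<in> N z" "y \<notin> N x0" by blast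
    moreover have "y \<noteq> x0" using y(1) nb_sym z by blast
    ultimately show ?thesis
      using large_non_nb(2)[OF x0 nb_V[OF y(1)]] small_nb(3)[OF z(1) z1 y(1)] by blast
  qed
qed

lemma large_ge:
  assumes "w \<in> V" "2 \<le> r w"
  shows "t - 1 - a \<le> a * r w"
proof (cases "w \<in> N x0")
  case True
  then show ?thesis using small_nb(2)[OF x0] a_cases by fastforce
next
  case False
  then show ?thesis using large_non_nb(1)[OF x0] assms x0 by fastforce
qed

text \<open>Nonnegativity of this count limits how far \<open>r v\<close> can exceed
  \<open>r w\<close>.\<close>

lemma card_diff_eq:
  assumes "w \<in> V" "v \<in> V" "v \<noteq> w"
  shows "int (card (N w - N v)) = t - a * r w * (r v - r w) + (if v \<in> N w then t - 1 else 0)"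
  using card_diff[of w v] degree[of w] common_adj[of w v] common_nonadj[of w v] assms
  by (auto simp: algebra_simps)

text \<open>A gap of three or more would give \<open>N w - N v\<close> negative size, since
  \<open>3 * (t - 1 - a) > 2 * t - 1\<close>.\<close>

lemma spread:
  assumes w: "w \<in> V" "2 \<le> r w" and v: "v \<in> V"
  shows "r v \<le> r w + 2"
proof (rule ccontr)
  assume "\<not> ?thesis"
  then have d: "3 \<le> r v - r w" by simp
  then have "int (card (N w - N v)) = t - a * r w * (r v - r w) + (if v \<in> N w then t - 1 else 0)"
    using w v by (intro card_diff_eq) auto
  then have "a * r w * (r v - r w) \<le> 2 * t - 1"
    using t_ge by (auto split: if_splits)
  moreover have "(t - 1 - a) * 3 \<le> a * r w * (r v - r w)"
    using large_ge[OF w] d t_ge a_cases by (intro mult_mono) auto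
  ultimately show False using t_ge a_cases by auto
qed

lemma eigen_upper:
  assumes w: "w \<in> V" "2 \<le> r w"
  shows "a * s * r w \<le> a * (t + a * r w * r w) * (r w + 2)"
proof -
  have "s * r w = (\<Sum>v\<in>N w. r v)" using eigen w by simp
  also have "\<dots> \<le> (\<Sum>v\<in>N w. r w + 2)"
    by (rule sum_mono) (use spread[OF w] nb_V in blast)
  also have "\<dots> = (t + a * r w * r w) * (r w + 2)" using degree w by simp
  finally show ?thesis using a_cases by (auto simp: mult.assoc)
qed

text \<open>Improves \<open>large_ge\<close> by one: if \<open>a * r w = t - 1 - a\<close>, then
  \<open>small_sum\<close> and \<open>eigen_upper\<close> bound \<open>s\<close> in contradictory
  ways.\<close>

lemma large_ge':
  assumes w: "w \<in> V" "2 \<le> r w"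
  shows "t - a \<le> a * r w"
proof (rule ccontr)
  define R where "R = r w"
  assume "\<not> ?thesis"
  then have R: "t = a * R + a + 1" using large_ge[OF w] by (simp add: R_def)
  have "(t + a) * (t - 1) * R \<le> a * s * R"
    using small_sum(2)[OF x0] w R_def by (intro mult_right_mono) auto
  then have E: "(t + a) * (t - 1) * R \<le> a * (t + a * R * R) * (R + 2)"
    using eigen_upper[OF w, folded R_def] by linarith
  from a_cases show False
  proof
    assume a: "a = 1"
    \<comment> \<open>Here \<open>R \<ge> 9\<close>, while \<open>E\<close> reduces to
      \<open>R * R \<le> R + 4\<close>.\<close>
    have "0 \<le> (R - 9) * (R + 8)" using R t_ge a by simp
    then show False using E R t_ge a by (simp add: algebra_simps)
  next
    assume a: "a = 2"
    have "0 \<le> (R - 4) * (R + 2)" using R t_ge a by simp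
    then show False using E R t_ge a by (simp add: algebra_simps)
  qed
qed

text \<open>
  Distinct weights of nonadjacent large vertices must be consecutive, and then a small vertex
  adjacent to only the heavier one would have too many common neighbours with it.
\<close>

lemma large_adjacent:
  assumes w: "w \<in> V" "2 \<le> r w" and v: "v \<in> V" and less: "r w < r v"
  shows "v \<in> N w"
proof (rule ccontr)
  assume non: "v \<notin> N w"
  then have non': "w \<notin> N v" using nb_sym[OF v] by blast
  define R where "R = r w"
  have cw: "int (card (N w - N v)) = t - a * R * (r v - R)"
    using card_diff_eq[OF w(1) v] less non R_def by auto
  have cv: "int (card (N v - N w)) = t + a * r v * (r v - R)"
    using card_diff_eq[OF v w(1)] less non' R_def by (auto simp: algebra_simps)
  have lo: "t - a \<le> a * R" using large_ge'[OF w] R_def by simp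
  \<comment> \<open>Since \<open>2 * (t - a) > t\<close>, a gap of two or more would give
    \<open>N w - N v\<close> negative size.\<close>
  have rv: "r v = R + 1"
  proof (rule ccontr)
    assume "\<not> ?thesis"
    then have "(t - a) * 2 \<le> a * R * (r v - R)"
      using lo less t_ge a_cases R_def by (intro mult_mono) auto
    then show False using cw t_ge a_cases by auto
  qed
  have R2: "2 \<le> R" using w R_def by simp
  have cw: "int (card (N w - N v)) = t - a * R" and cv: "int (card (N v - N w)) = t + a * R + a"
    using cw cv rv by (auto simp: algebra_simps)
  have ub: "a * R \<le> t" using cw by simp
  \<comment> \<open>Otherwise all of \<open>N v - N w\<close> is large, and the difference of the
    eigenvector equations at \<open>v\<close> and \<open>w\<close> makes \<open>s\<close> exceed
    what \<open>eigen_upper\<close> allows at \<open>w\<close>.\<close>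
  have "\<exists>x \<in> V. r x = 1 \<and> x \<in> N v \<and> x \<notin> N w"
  proof (rule ccontr)
    assume "\<not> ?thesis"
    then have "\<And>x. x \<in> N v - N w \<Longrightarrow> 2 \<le> r x" using nb_V r_pos by force
    then have "(\<Sum>x\<in>N v - N w. t - a) \<le> (\<Sum>x\<in>N v - N w. a * r x)"
      by (intro sum_mono) (use large_ge' nb_V in blast)
    then have s1: "(t + a * R + a) * (t - a) \<le> (\<Sum>x\<in>N v - N w. a * r x)" using cv by simp
    have "a * r x \<le> a * (R + 2)" if "x \<in> N w" for x
      using spread[OF w nb_V[OF that]] a_cases R_def by auto
    then have "(\<Sum>x\<in>N w - N v. a * r x) \<le> (\<Sum>x\<in>N w - N v. a * (R + 2))"
      by (intro sum_mono) blast
    then have s2: "(\<Sum>x\<in>N w - N v. a * r x) \<le> (t - a * R) * (a * (R + 2))" using cw by simp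
    have "a * s * R = (\<Sum>x\<in>N w. a * r x)"
      using eigen[OF w(1)] by (simp add: sum_distrib_left[symmetric] R_def)
    also have "\<dots> = (\<Sum>x\<in>N w \<inter> N v. a * r x) + (\<Sum>x\<in>N w - N v. a * r x)"
      by (rule sum.Int_Diff) simp
    finally have e1: "a * s * R = (\<Sum>x\<in>N w \<inter> N v. a * r x) + (\<Sum>x\<in>N w - N v. a * r x)" .
    have "a * s * (R + 1) = (\<Sum>x\<in>N v. a * r x)"
      using eigen[OF v] rv by (simp add: sum_distrib_left[symmetric])
    also have "\<dots> = (\<Sum>x\<in>N w \<inter> N v. a * r x) + (\<Sum>x\<in>N v - N w. a * r x)"
      using sum.Int_Diff[of "N v" "\<lambda>x. a * r x" "N w"] by (simp add: Int_commute)
    finally have e2: "a * s * (R + 1) = (\<Sum>x\<in>N w \<inter> N v. a * r x) + (\<Sum>x\<in>N v - N w. a * r x)" .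
    have "(t + a * R + a) * (t - a) - (t - a * R) * (a * (R + 2)) \<le> a * s"
      using e1 e2 s1 s2 by (simp add: distrib_left)
    then have "((t + a * R + a) * (t - a) - (t - a * R) * (a * (R + 2))) * R \<le> a * s * R"
      using R2 by (intro mult_right_mono) auto
    then have E: "((t + a * R + a) * (t - a) - (t - a * R) * (a * (R + 2))) * R
        \<le> a * (t + a * R * R) * (R + 2)"
      using eigen_upper[OF w, folded R_def] by linarith
    \<comment> \<open>By \<open>lo\<close> and \<open>ub\<close>, \<open>t - a * R\<close> lies
      between \<open>0\<close> and \<open>a\<close>; in each of the five resulting cases
      \<open>E\<close> is a cubic inequality that fails for such large \<open>R\<close>.\<close>
    have "t = a * R \<or> t = a * R + 1 \<or> a = 2 \<and> t = a * R + 2"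
      using lo ub a_cases by (smt (verit))
    then consider "a = 1" "t = R" | "a = 1" "t = R + 1" | "a = 2" "t = 2 * R" | "a = 2" "t = 2 * R + 1"
      | "a = 2" "t = 2 * R + 2"
      using a_cases by force
    then show False
    proof cases
      case 1
      then have "R * (R * R) \<le> 3 * R + 4 * (R * R)" using E by (simp add: algebra_simps)
      moreover have "11 * (R * R) \<le> R * (R * R)" "11 * R \<le> R * R"
        using 1 t_ge by (intro mult_right_mono; simp)+
      ultimately show False using 1 t_ge by linarith
    next
      case 2
      then have "R * (R * R) \<le> 2 + 5 * R + 2 * (R * R)" using E by (simp add: algebra_simps)
      moreover have "10 * (R * R) \<le> R * (R * R)" "10 * R \<le> R * R"
        using 2 t_ge by (intro mult_right_mono; simp)+
      ultimately show False using 2 t_ge by linarith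
    next
      case 3
      then have "4 * (R * (R * R)) \<le> 12 * R + 16 * (R * R)" using E by (simp add: algebra_simps)
      moreover have "6 * (R * R) \<le> R * (R * R)" "6 * R \<le> R * R"
        using 3 t_ge by (intro mult_right_mono; simp)+
      ultimately show False using 3 t_ge by linarith
    next
      case 4
      then have "4 * (R * (R * R)) \<le> 4 + 17 * R + 12 * (R * R)" using E by (simp add: algebra_simps)
      moreover have "5 * (R * R) \<le> R * (R * R)" "5 * R \<le> R * R"
        using 4 t_ge by (intro mult_right_mono; simp)+
      ultimately show False using 4 t_ge by linarith
    next
      case 5
      then have "4 * (R * (R * R)) \<le> 8 + 20 * R + 8 * (R * R)" using E by (simp add: algebra_simps)
      moreover have "5 * (R * R) \<le> R * (R * R)" "5 * R \<le> R * R"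
        using 5 t_ge by (intro mult_right_mono; simp)+
      ultimately show False using 5 t_ge by linarith
    qed
  qed
  then obtain x where x: "x \<in> V" "r x = 1" and xv: "x \<in> N v" and xw: "x \<notin> N w" by blast
  have vx: "v \<in> N x" using nb_sym[OF v xv] .
  have wx: "w \<noteq> x" using w x by auto
  have xw': "w \<notin> N x" using nb_sym[OF x(1)] xw by blast
  \<comment> \<open>A common neighbour of \<open>x\<close> and \<open>w\<close> not adjacent to
    \<open>v\<close> lies in \<open>N w - N v\<close>; the counts then give
    \<open>a * R \<le> a + 1\<close>.\<close>
  have "N x \<inter> N w \<subseteq> (N x \<inter> N v) \<union> (N w - N v)" by blast
  then have "card (N x \<inter> N w) \<le> card ((N x \<inter> N v) \<union> (N w - N v))" by (intro card_mono) auto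
  also have "\<dots> \<le> card (N x \<inter> N v) + card (N w - N v)" by (rule card_Un_le)
  finally have "a * R \<le> (a * r v - t + 1) + (t - a * R)"
    using small_non_nb(1)[OF x w(1) wx xw'] small_nb(1)[OF x vx] cw
    unfolding R_def by linarith
  moreover have "a * r v = a * R + a" using rv by (simp add: distrib_left)
  ultimately show False using lo t_ge a_cases by linarith
qed

text \<open>If two weights occurred, the common neighbours of \<open>x\<close> with \<open>u\<close>
  and of \<open>x\<close> with \<open>v\<close> would cover \<open>N x\<close>, which makes
  \<open>r u + r v\<close> large. But \<open>r u\<close>, being minimal, is below the average weight
  on \<open>N x\<close>, which \<open>s_upper\<close> restricts.\<close>

lemma small_nb_const:
  assumes x: "x \<in> V" "r x = 1" and y: "y \<in> N x" and z: "z \<in> N x"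
  shows "r y = r z"
proof (rule ccontr)
  assume ne: "r y \<noteq> r z"
  obtain u where u: "u \<in> N x" "\<And>v. v \<in> N x \<Longrightarrow> r u \<le> r v"
    using ex_min_if_finite[of "r ` N x"] y
    by (metis arg_min_if_finite(1) arg_min_least empty_iff fin_nb)
  have "r u < r y \<or> r u < r z" using u(2)[OF y] u(2)[OF z] ne by linarith
  then obtain v where v: "v \<in> N x" "r u < r v" using y z by blast
  have large: "\<And>v. v \<in> N x \<Longrightarrow> v \<in> V \<and> 2 \<le> r v" using small_nb(3)[OF x] nb_V by blast
  \<comment> \<open>By \<open>large_adjacent\<close>, neighbours of \<open>x\<close> of distinct
    weights are adjacent.\<close>
  have "{w \<in> N x. r w \<noteq> r q} \<subseteq> N x \<inter> N q" if q: "q \<in> N x" for q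
  proof safe
    fix w assume w: "w \<in> N x" "r w \<noteq> r q"
    show "w \<in> N q"
    proof (cases "r w < r q")
      case True
      then have "q \<in> N w" using large_adjacent large w q by blast
      then show ?thesis using nb_sym large w by blast
    next
      case False
      then show ?thesis using large_adjacent[of q w] large w q by simp
    qed
  qed
  then have e: "int (card {w \<in> N x. r w \<noteq> r q}) \<le> a * r q - t + 1" if "q \<in> N x" for q
    using that small_nb(1)[OF x that] card_mono[of "N x \<inter> N q" "{w \<in> N x. r w \<noteq> r q}"] by force
  have "N x \<subseteq> {w \<in> N x. r w \<noteq> r u} \<union> {w \<in> N x. r w \<noteq> r v}" using v by auto
  then have "card (N x) \<le> card ({w \<in> N x. r w \<noteq> r u} \<union> {w \<in> N x. r w \<noteq> r v})"
    by (intro card_mono) auto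
  also have "\<dots> \<le> card {w \<in> N x. r w \<noteq> r u} + card {w \<in> N x. r w \<noteq> r v}" by (rule card_Un_le)
  finally have k: "t + a \<le> a * r u + a * r v - 2 * t + 2"
    using e[OF u(1)] e[OF v(1)] degree_small[OF x] by linarith
  have ruv: "a * r v \<le> a * r u + 2 * a" using spread[of u v] large u v a_cases by auto
  have "(\<Sum>w\<in>N x. r u) < (\<Sum>w\<in>N x. r w)"
    using u v by (intro sum_strict_mono_ex1) auto
  then have "(t + a) * r u < s" using small_sum(1)[OF x] degree_small[OF x] by simp
  then have "(t + a) * (a * r u) < a * s" using a_cases by auto
  then have "(t + a) * (a * r u) < (t + a) * (t + 2 * a)" using s_upper by linarith
  then have "a * r u < t + 2 * a" using t_ge a_cases by (auto simp: mult_less_cancel_left)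
  \<comment> \<open>The three bounds combine to \<open>t \<le> 5 * a\<close>.\<close>
  then show False using k ruv t_ge a_cases by auto
qed

text \<open>A third weight \<open>K\<close> beside \<open>1\<close> and the weight \<open>L\<close>
  of the neighbours of \<open>x0\<close> satisfies \<open>a * K = t + a\<close>, while
  \<open>s = (t + a) * L\<close>. The eigenvector equation then fails at \<open>v\<close> if
  \<open>L < K\<close>, and at \<open>y\<close> if \<open>K < L\<close>.\<close>

theorem at_most_two_weights: "\<exists>p q. \<forall>v \<in> V. r v = p \<or> r v = q"
proof (rule ccontr)
  assume third: "\<not> ?thesis"
  have "N x0 \<noteq> {}" using degree_small[OF x0] t_ge a_cases by auto
  then obtain y where y: "y \<in> N x0" by blast
  define L where "L = r y"
  have yV: "y \<in> V" using y nb_V by blast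
  have constL: "r u = L" if "u \<in> N x0" for u using small_nb_const[OF x0 that y] L_def by simp
  obtain v where v: "v \<in> V" "r v \<noteq> 1" "r v \<noteq> L" using third by blast
  define K where "K = r v"
  have v2: "2 \<le> r v" using v r_pos by force
  have L2: "2 \<le> L" using small_nb(3)[OF x0 y] L_def by simp
  \<comment> \<open>A large \<open>u\<close> of weight other than that on \<open>N x\<close> is
    joined to all of \<open>N x\<close>, so the count \<open>a * r u\<close> is the whole valency of
    \<open>x\<close>.\<close>
  have full: "a * r u = t + a"
    if x: "x \<in> V" "r x = 1" and z: "z \<in> N x" and u: "u \<in> V" "2 \<le> r u" "r u \<noteq> r z" for x z u
  proof -
    have "w \<in> N u" if w: "w \<in> N x" for w
    proof -
      have wr: "r w = r z" "w \<in> V" "2 \<le> r w"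
        using small_nb_const[OF x w z] small_nb(3)[OF x w] nb_V w by auto
      show ?thesis
      proof (cases "r u < r w")
        case True
        then show ?thesis using large_adjacent u wr by blast
      next
        case False
        then have "u \<in> N w" using large_adjacent[of w u] u wr by simp
        then show ?thesis using nb_sym wr by blast
      qed
    qed
    then have "N x \<inter> N u = N x" by blast
    moreover have "u \<noteq> x" "u \<notin> N x" using u x small_nb_const[OF x _ z] by auto
    ultimately show ?thesis using small_non_nb(1)[OF x u(1)] degree_small[OF x] by simp
  qed
  have K: "a * K = t + a" using full[OF x0 y v(1) v2] v L_def K_def by simp
  have LK: "r u = L \<or> r u = K" if "u \<in> V" "2 \<le> r u" for u
  proof (cases "r u = L")
    case False
    then have "a * r u = a * K" using full[OF x0 y that] K L_def by simp
    then show ?thesis using a_cases by auto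
  qed simp
  have s: "s = (t + a) * L"
    using small_sum(1)[OF x0] constL degree_small[OF x0] by simp
  \<comment> \<open>All neighbours of a small neighbour of \<open>v\<close> have weight
    \<open>K\<close>, so \<open>full\<close> would apply to \<open>y\<close> and force
    \<open>L = K\<close>.\<close>
  have v_large: "2 \<le> r u" if "u \<in> N v" for u
  proof (rule ccontr)
    assume "\<not> ?thesis"
    then have u: "u \<in> V" "r u = 1" using r_pos nb_V that by force+
    have "v \<in> N u" using nb_sym[OF v(1) that] .
    then have "a * L = t + a" using full[OF u _ yV] v L2 L_def by auto
    then show False using K v a_cases K_def by auto
  qed
  have "\<not> L < K"
  proof
    assume less: "L < K"
    have "(\<Sum>u\<in>N v. L) \<le> (\<Sum>u\<in>N v. r u)"
      by (rule sum_mono) (use LK v_large less nb_V in force)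
    then have "(t + a * K * K) * L \<le> (t + a) * L * K"
      using eigen[OF v(1)] degree[OF v(1)] s K_def by simp
    moreover have "(t + a) * L * K = a * K * K * L"
      unfolding K[symmetric] by simp
    ultimately have "t * L \<le> 0" by (simp add: distrib_right)
    then show False using t_ge L2 by (simp add: mult_le_0_iff)
  qed
  then have less: "K < L" using v K_def by simp
  \<comment> \<open>With \<open>a * L > t + a\<close>, no vertex of weight \<open>L\<close> is a
    non-neighbour of a small vertex. So a second small vertex would share all of
    \<open>N x0\<close>, yet nonadjacent small vertices have only \<open>a\<close> common
    neighbours.\<close>
  have only_x0: "u = x0" if u: "u \<in> V" "r u = 1" for u
  proof (rule ccontr)
    assume ne: "u \<noteq> x0"
    have "w \<in> N u" if w: "w \<in> N x0" for w
    proof (rule ccontr)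
      assume "w \<notin> N u"
      moreover have "w \<in> V" "r w = L" using w nb_V constL by auto
      moreover from this have "w \<noteq> u" using u L2 by auto
      ultimately have "a * L \<le> t + a" using small_non_nb(2)[OF u, of w] by simp
      then show False using K less a_cases by auto
    qed
    then have sub: "N x0 \<inter> N u = N x0" by blast
    have "u \<notin> N x0" using u constL L2 by force
    then have "int (card (N x0 \<inter> N u)) = a" using small_non_nb(1)[OF x0 u(1)] ne u by simp
    then show False using sub degree_small[OF x0] t_ge by simp
  qed
  define e where "e = a * L - t + 1"
  have e: "int (card (N y \<inter> N x0)) = e"
    using small_nb(1)[OF x0 y] L_def e_def by (simp add: Int_commute)
  have x0y: "x0 \<in> N y" using nb_sym[OF x0(1) y] .
  have rest: "r u = K" if "u \<in> N y - N x0 - {x0}" for u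
  proof -
    have u: "u \<in> V" "2 \<le> r u" using that nb_V only_x0 r_pos by force+
    have "r u \<noteq> L"
    proof
      assume "r u = L"
      then show False using small_non_nb(2)[OF x0 u(1)] that K less a_cases by auto
    qed
    then show ?thesis using LK[OF u] by simp
  qed
  have "x0 \<in> N y - N x0" using x0y nb_irrefl by blast
  then have "(\<Sum>u\<in>N y - N x0. r u) = 1 + (\<Sum>u\<in>N y - N x0 - {x0}. r u)"
    and "int (card (N y - N x0)) = 1 + int (card (N y - N x0 - {x0}))"
    using x0 sum.remove[of "N y - N x0" x0 r] card.remove[of "N y - N x0" x0] by auto
  moreover have "(\<Sum>u\<in>N y - N x0 - {x0}. r u) = int (card (N y - N x0 - {x0})) * K"
    using rest by simp
  moreover have "int (card (N y - N x0)) = t + a * L * L - e"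
    using card_diff[of y x0] e degree[OF yV] L_def by simp
  moreover have "(\<Sum>u\<in>N y \<inter> N x0. r u) = e * L" using constL e by simp
  moreover have "s * L = (\<Sum>u\<in>N y \<inter> N x0. r u) + (\<Sum>u\<in>N y - N x0. r u)"
    using eigen[OF yV] sum.Int_Diff[of "N y" r "N x0"] L_def by simp
  \<comment> \<open>The neighbours of \<open>y\<close> are \<open>e\<close> vertices of weight
    \<open>L\<close>, the vertex \<open>x0\<close> of weight \<open>1\<close>, and otherwise
    vertices of weight \<open>K\<close>.\<close>
  ultimately have "s * L = e * L + 1 + (t + a * L * L - e - 1) * K" by simp
  then have "a * (s * L) = a * (e * L + 1 + (t + a * L * L - e - 1) * K)" by simp
  then have "a * s * L = a * e * L + a + (t + a * L * L - e - 1) * (a * K)"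
    by (simp add: algebra_simps)
  \<comment> \<open>Substituting \<open>a * K = t + a\<close> and \<open>s = (t + a) * L\<close>
    cancels the terms quadratic in \<open>L\<close>; the remaining summands cannot add up to
    zero.\<close>
  then have "0 = e * (a * L - (t + a)) + a + (t + a) * (t - 1)"
    unfolding K s by (simp add: algebra_simps)
  moreover have "0 \<le> e * (a * L - (t + a))" using e K less a_cases by (intro mult_nonneg_nonneg) auto
  moreover have "0 < (t + a) * (t - 1)" using t_ge a_cases by auto
  ultimately show False using a_cases by auto
qed

end

section \<open>Integrality and the main theorem\<close>

text \<open>
  With \<open>a = \<alpha>(x\<^sub>0)\<^sup>2\<close>, a neighbour of \<open>x\<^sub>0\<close> shows that \<open>a\<close> is rational, and a non-neighbour that \<open>a\<close>
  is a root of a monic integral quadratic.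
\<close>

lemma ex_integral_scaling:
  fixes V :: "'v set" and \<alpha> :: "'v \<Rightarrow> real" and s t :: real
  assumes fin: "finite V"
    and nb_sub: "\<And>u. N u \<subseteq> V"
    and nb_sym: "\<And>u v. u \<in> V \<Longrightarrow> v \<in> N u \<Longrightarrow> u \<in> N v"
    and nb_irrefl: "\<And>u. u \<notin> N u"
    and deg: "\<And>u. u \<in> V \<Longrightarrow> real (card (N u)) = t + \<alpha> u * \<alpha> u"
    and common_adj: "\<And>u v. u \<in> V \<Longrightarrow> v \<in> N u \<Longrightarrow> real (card (N u \<inter> N v)) = \<alpha> u * \<alpha> v - t + 1"
    and common_nonadj: "\<And>u v. u \<in> V \<Longrightarrow> v \<in> V \<Longrightarrow> u \<noteq> v \<Longrightarrow> v \<notin> N u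
          \<Longrightarrow> real (card (N u \<inter> N v)) = \<alpha> u * \<alpha> v"
    and eigen: "\<And>u. u \<in> V \<Longrightarrow> (\<Sum>v\<in>N u. \<alpha> v) = s * \<alpha> u"
    and pos: "\<And>u. u \<in> V \<Longrightarrow> 0 < \<alpha> u"
    and t_ge: "11 \<le> t"
    and not_cone: "\<And>u. u \<in> V \<Longrightarrow> \<exists>v \<in> V. v \<noteq> u \<and> v \<notin> N u"
    and x0: "x0 \<in> V" "\<alpha> x0 * \<alpha> x0 < 3"
  shows "\<exists>r T a S. scaled_graph_small V N r T a S x0"
proof -
  define a where "a = \<alpha> x0 * \<alpha> x0"
  have a_pos: "0 < a" using pos[OF x0(1)] by (simp add: a_def)
  define k where "k = int (card (N x0))"
  have t: "t = of_int k - a" using deg[OF x0(1)] by (simp add: k_def a_def)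
  \<comment> \<open>By the common-neighbour counts, \<open>m u\<close> is an integer or an integer
    minus \<open>a\<close> for \<open>u\<close> other than \<open>x0\<close>, so \<open>m_sq\<close>
    becomes an equation for \<open>a\<close> with integer coefficients.\<close>
  define m where "m u = \<alpha> x0 * \<alpha> u" for u
  have m_sq: "m u * m u = a * (of_int (int (card (N u)) - k) + a)" if "u \<in> V" for u
  proof -
    have "m u * m u = a * (\<alpha> u * \<alpha> u)" by (simp add: m_def a_def)
    moreover have "\<alpha> u * \<alpha> u = of_int (int (card (N u)) - k) + a" using deg[OF that] t by simp
    ultimately show ?thesis by simp
  qed
  have m_nb: "m u = of_int (int (card (N x0 \<inter> N u)) + k - 1) - a" if "u \<in> N x0" for u
    using common_adj[OF x0(1) that] t by (simp add: m_def)
  have m_non: "m u = of_int (int (card (N x0 \<inter> N u)))" if "u \<in> V" "u \<noteq> x0" "u \<notin> N x0" for u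
    using common_nonadj[OF x0(1) that(1)] that by (simp add: m_def)
  have k11: "11 < k" using t t_ge a_pos by linarith
  have "a \<in> \<rat>"
  proof -
    have "N x0 \<noteq> {}" using k11 by (auto simp: k_def)
    then obtain y where y: "y \<in> N x0" by blast
    define e where "e = int (card (N x0 \<inter> N y)) + k - 1"
    define j where "j = int (card (N y)) - k + 2 * e"
    have "e > 0" using k11 by (simp add: e_def)
    have "(of_int e - a) * (of_int e - a) = a * (of_int (int (card (N y)) - k) + a)"
      using m_sq[of y] m_nb[OF y] nb_sub y by (auto simp: e_def)
    \<comment> \<open>The squares of \<open>a\<close> cancel, so the equation is linear in
      \<open>a\<close>.\<close>
    then have aj: "a * of_int j = of_int (e * e)" by (simp add: j_def algebra_simps)
    with \<open>e > 0\<close> have "real_of_int j \<noteq> 0" by auto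
    with aj have "a = of_int (e * e) / of_int j" by (simp add: field_simps)
    then show ?thesis by simp
  qed
  moreover have "algebraic_int a"
  proof -
    obtain z where z: "z \<in> V" "z \<noteq> x0" "z \<notin> N x0" using not_cone x0(1) by blast
    define c where "c = int (card (N x0 \<inter> N z))"
    define d where "d = int (card (N z)) - k"
    have eq: "of_int c * of_int c = a * (of_int d + a)"
      using m_sq[OF z(1)] m_non[OF z] by (simp add: c_def d_def)
    show ?thesis
    proof (rule algebraic_int.intros)
      show "lead_coeff [:- of_int (c * c), of_int d, 1::real:] = 1" by simp
      show "\<forall>i. coeff [:- of_int (c * c), of_int d, 1::real:] i \<in> \<int>"
        by (auto simp: coeff_pCons split: nat.splits)
      show "poly [:- of_int (c * c), of_int d, 1:] a = 0"
        using eq by (simp add: algebra_simps)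
    qed
  qed
  ultimately have "a \<in> \<int>" by (intro rational_algebraic_int_is_int)
  then obtain a' where a': "a = of_int a'" by (rule Ints_cases)
  have a'_cases: "a' = 1 \<or> a' = 2"
    using a_pos x0(2) unfolding a_def[symmetric] a' by auto
  define T where "T = k - a'"
  have T: "t = of_int T" using t a' by (simp add: T_def)
  have "\<exists>R. \<alpha> u = \<alpha> x0 * of_int R \<and> 1 \<le> R" if u: "u \<in> V" for u
  proof -
    have "\<exists>M. m u = of_int M"
    proof -
      consider "u = x0" | "u \<in> N x0" | "u \<noteq> x0" "u \<notin> N x0" by blast
      then show ?thesis
      proof cases
        case 1
        then show ?thesis using a' by (auto simp: m_def a_def)
      next
        case 2
        then show ?thesis using m_nb a' by (metis of_int_diff)
      qed (use m_non u in blast)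
    qed
    then obtain M where M: "m u = of_int M" by blast
    have "real_of_int (M * M) = real_of_int (a' * (int (card (N u)) - k + a'))"
      using m_sq[OF u] M a' by simp
    then have MM: "M * M = a' * (int (card (N u)) - k + a')" by (simp only: of_int_eq_iff)
    \<comment> \<open>For \<open>a' = 2\<close>, \<open>MM\<close> makes the square of
      \<open>M\<close> even, hence \<open>M\<close> even; the quotient is the integral
      weight.\<close>
    have "a' dvd M"
    proof (cases "a' = 1")
      case False
      then have "even (M * M)" using MM a'_cases by simp
      then show ?thesis using False a'_cases by simp
    qed simp
    then obtain R where R: "M = a' * R" by blast
    have "\<alpha> x0 * \<alpha> u = \<alpha> x0 * (\<alpha> x0 * of_int R)"
      using M R a' by (simp add: m_def a_def)
    then have eq: "\<alpha> u = \<alpha> x0 * of_int R" using pos[OF x0(1)] by simp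
    then have "0 < real_of_int R" using pos[OF u] pos[OF x0(1)] by (simp add: zero_less_mult_iff)
    then show ?thesis using eq by auto
  qed
  then obtain r where r: "\<And>u. u \<in> V \<Longrightarrow> \<alpha> u = \<alpha> x0 * of_int (r u)" "\<And>u. u \<in> V \<Longrightarrow> 1 \<le> r u"
    by metis
  have rx0: "r x0 = 1" using r(1)[OF x0(1)] pos[OF x0(1)] by simp
  have prod: "\<alpha> u * \<alpha> v = of_int (a' * r u * r v)" if "u \<in> V" "v \<in> V" for u v
    using r(1)[OF that(1)] r(1)[OF that(2)] a' by (simp add: a_def)
  have sum_r: "real_of_int (\<Sum>v\<in>N u. r v) = s * of_int (r u)" if u: "u \<in> V" for u
  proof -
    have "(\<Sum>v\<in>N u. \<alpha> v) = (\<Sum>v\<in>N u. \<alpha> x0 * of_int (r v))"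
      by (rule sum.cong) (use r(1) nb_sub in blast)+
    then have "\<alpha> x0 * of_int (\<Sum>v\<in>N u. r v) = \<alpha> x0 * (s * of_int (r u))"
      using eigen[OF u] r(1)[OF u] by (simp add: sum_distrib_left mult.left_commute)
    then show ?thesis using pos[OF x0(1)] by simp
  qed
  define S where "S = (\<Sum>v\<in>N x0. r v)"
  have S: "s = of_int S" using sum_r[OF x0(1)] rx0 by (simp add: S_def)
  have "scaled_graph_small V N r T a' S x0"
  proof
    fix u assume u: "u \<in> V"
    have "real_of_int (int (card (N u))) = real_of_int (T + a' * r u * r u)"
      using deg[OF u] prod[OF u u] T by simp
    then show "int (card (N u)) = T + a' * r u * r u" by (simp only: of_int_eq_iff)
    have "real_of_int (\<Sum>v\<in>N u. r v) = real_of_int (S * r u)" using sum_r[OF u] S by simp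
    then show "(\<Sum>v\<in>N u. r v) = S * r u" by (simp only: of_int_eq_iff)
  next
    fix u v assume u: "u \<in> V" and v: "v \<in> N u"
    then have "real_of_int (int (card (N u \<inter> N v))) = real_of_int (a' * r u * r v - T + 1)"
      using common_adj[OF u v] prod[of u v] nb_sub T by auto
    then show "int (card (N u \<inter> N v)) = a' * r u * r v - T + 1" by (simp only: of_int_eq_iff)
  next
    fix u v assume "u \<in> V" "v \<in> V" "u \<noteq> v" "v \<notin> N u"
    then have "real_of_int (int (card (N u \<inter> N v))) = real_of_int (a' * r u * r v)"
      using common_nonadj[of u v] prod[of u v] by simp
    then show "int (card (N u \<inter> N v)) = a' * r u * r v" by (simp only: of_int_eq_iff)
  next
    show "11 \<le> T" using t_ge T by simp
  qed (fact fin nb_sub nb_sym nb_irrefl r(2) a'_cases not_cone x0(1) rx0)+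
  then show ?thesis by blast
qed

section \<open>Eigenvalues and valencies in terms of vertices\<close>

lemma eigenvalue_adjacency_mat:
  assumes "distinct vs"
  shows "eigenvalue (adjacency_mat G vs) \<theta> \<longleftrightarrow>
    (\<exists>f. (\<exists>u\<in>set vs. f u \<noteq> 0) \<and>
      (\<forall>u\<in>set vs. (\<Sum>w\<in>set vs. of_bool (u \<rightarrow>\<^bsub>G\<^esub> w) * f w) = \<theta> * f u))"
    (is "?L \<longleftrightarrow> ?R")
proof -
  define n where "n = length vs"
  have bij: "bij_betw ((!) vs) {0..<n} (set vs)"
    using assms by (intro bij_betw_nth) (auto simp: n_def)
  have row: "(adjacency_mat G vs *\<^sub>v vec n (\<lambda>i. f (vs ! i))) $ i
      = (\<Sum>w\<in>set vs. of_bool (vs ! i \<rightarrow>\<^bsub>G\<^esub> w) * f w)" if "i < n" for f i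
  proof -
    have "(\<Sum>w\<in>set vs. of_bool (vs ! i \<rightarrow>\<^bsub>G\<^esub> w) * f w)
        = (\<Sum>j\<in>{0..<n}. of_bool (vs ! i \<rightarrow>\<^bsub>G\<^esub> vs ! j) * f (vs ! j))"
      by (rule sum.reindex_bij_betw[OF bij, symmetric])
    then show ?thesis
      using that by (simp add: adjacency_mat_def n_def scalar_prod_def of_bool_def)
  qed
  have dim: "dim_row (adjacency_mat G vs) = n" by (simp add: adjacency_mat_def n_def)
  have set: "set vs = (!) vs ` {0..<n}" using bij by (simp add: bij_betw_def)
  have ev: "eigenvector (adjacency_mat G vs) (vec n (\<lambda>i. f (vs ! i))) \<theta> \<longleftrightarrow>
      (\<exists>u\<in>set vs. f u \<noteq> 0) \<and>
      (\<forall>u\<in>set vs. (\<Sum>w\<in>set vs. of_bool (u \<rightarrow>\<^bsub>G\<^esub> w) * f w) = \<theta> * f u)" for f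
  proof -
    have "vec n (\<lambda>i. f (vs ! i)) \<noteq> 0\<^sub>v n \<longleftrightarrow> (\<exists>u\<in>set vs. f u \<noteq> 0)"
      by (auto simp: vec_eq_iff in_set_conv_nth Bex_def n_def)
    moreover have "adjacency_mat G vs *\<^sub>v vec n (\<lambda>i. f (vs ! i)) = \<theta> \<cdot>\<^sub>v vec n (\<lambda>i. f (vs ! i)) \<longleftrightarrow>
        (\<forall>i<n. (\<Sum>w\<in>set vs. of_bool (vs ! i \<rightarrow>\<^bsub>G\<^esub> w) * f w) = \<theta> * f (vs ! i))"
      using row dim by (auto simp: vec_eq_iff simp del: index_mult_mat_vec)
    moreover have "\<dots> \<longleftrightarrow> (\<forall>u\<in>set vs. (\<Sum>w\<in>set vs. of_bool (u \<rightarrow>\<^bsub>G\<^esub> w) * f w) = \<theta> * f u)"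
      by (simp only: all_set_conv_all_nth n_def)
    ultimately show ?thesis by (simp add: eigenvector_def dim)
  qed
  show ?thesis
  proof
    assume ?L
    then obtain v where v: "eigenvector (adjacency_mat G vs) v \<theta>" by (auto simp: eigenvalue_def)
    define f where "f u = v $ (the_inv_into {0..<n} ((!) vs) u)" for u
    have "v = vec n (\<lambda>i. f (vs ! i))"
      using v bij by (intro eq_vecI) (auto simp: f_def eigenvector_def dim bij_betw_def the_inv_into_f_f)
    then show ?R using v ev[of f] by blast
  next
    assume ?R
    then show ?L using ev unfolding eigenvalue_def by blast
  qed
qed

text \<open>Without parallel arcs, \<open>head\<close> is injective on the arcs leaving
  \<open>u\<close>.\<close>

lemma (in graph) out_degree_eq_card_dominated: "out_degree G u = card {v. u \<rightarrow> v}"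
proof -
  have "bij_betw (head G) (out_arcs G u) {v. u \<rightarrow> v}"
    unfolding bij_betw_def
  proof
    show "inj_on (head G) (out_arcs G u)"
      using no_multi_arcs by (intro inj_onI) (auto simp: arc_to_ends_def)
    show "head G ` out_arcs G u = {v. u \<rightarrow> v}"
      by (auto simp: arcs_ends_conv image_iff)
  qed
  then show ?thesis by (simp add: out_degree_def bij_betw_same_card)
qed

theorem theorem4p11:
  fixes G :: "('v, 'e) pre_digraph" and vs :: "'v list" and s t :: real
  assumes "t \<ge> 11"
    and "graph G"
    and "Digraph_Component.connected G"
    and "\<not> regular G"
    and "distinct vs" and "set vs = verts G"
    and "spectrum (adjacency_mat G vs) = {s, 1, - t}"
    and "s > 1" and "1 > - t"
    and "\<not> cone G"
    and "\<not> biregular G"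
  shows "real (min_valency G) \<ge> t + 3"
proof (rule ccontr)
  assume small: "\<not> real (min_valency G) \<ge> t + 3"
  interpret graph G by fact
  define V where "V = verts G"
  define N where "N u = {v. u \<rightarrow>\<^bsub>G\<^esub> v}" for u
  have fin: "finite V" by (simp add: V_def)
  have N_sub: "N u \<subseteq> V" for u using adj_in_verts by (auto simp: N_def V_def)
  have fin_N: "finite (N u)" for u using fin N_sub finite_subset by blast
  have N_sym: "v \<in> N u \<longleftrightarrow> u \<in> N v" for u v
    using arcs_ends_symmetric[OF sym_arcs] by (auto simp: N_def)
  have N_irrefl: "u \<notin> N u" for u
    using no_loops by (auto simp: N_def arcs_ends_conv)
  have out_deg: "out_degree G u = card (N u)" for u
    by (simp add: N_def out_degree_eq_card_dominated)
  have strong: "V \<noteq> {}" "\<And>u v. u \<in> V \<Longrightarrow> v \<in> V \<Longrightarrow> u \<rightarrow>\<^sup>*\<^bsub>G\<^esub> v"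
    using assms(3) reachable_mk_symmetric_eq[OF sym_arcs]
    by (auto simp: V_def Digraph_Component.connected_def strongly_connected_def)
  define A :: "'v \<Rightarrow> 'v \<Rightarrow> real" where "A u v = of_bool (v \<in> N u)" for u v
  interpret A: symmetric_kernel V A
    using fin by unfold_locales (simp_all add: A_def N_sym)
  have op_eq: "A.op f u = (\<Sum>w\<in>V. of_bool (u \<rightarrow>\<^bsub>G\<^esub> w) * f w)" for f :: "'v \<Rightarrow> real" and u
    by (simp add: A.op_def A_def N_def)
  have ev: "eigenvalue (adjacency_mat G vs) \<theta> \<longleftrightarrow>
      (\<exists>f. (\<exists>u\<in>V. f u \<noteq> 0) \<and> (\<forall>u\<in>V. A.op f u = \<theta> * f u))" for \<theta>
    using eigenvalue_adjacency_mat[OF assms(5), of G \<theta>]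
    unfolding op_eq assms(6) V_def[symmetric] .
  have spec: "eigenvalue (adjacency_mat G vs) \<theta> \<longleftrightarrow> \<theta> \<in> {s, 1, - t}" for \<theta>
    using assms(7) by (auto simp: spectrum_def)
  interpret A: three_eigenvalue_kernel V A s t
  proof
    \<comment> \<open>A set closed under neighbours contains everything reachable from it.\<close>
    show "U = V" if U: "U \<subseteq> V" "U \<noteq> {}" "\<And>u w. u \<in> U \<Longrightarrow> w \<in> V \<Longrightarrow> A u w \<noteq> 0 \<Longrightarrow> w \<in> U" for U
    proof -
      obtain u where u: "u \<in> U" using U by blast
      have "w \<in> U" if "w \<in> V" for w
      proof -
        have "u \<rightarrow>\<^sup>*\<^bsub>G\<^esub> w" using strong u U that by blast
        then show ?thesis
        proof (induction rule: reachable_induct)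
          case (step x y)
          then have "y \<in> N x" by (simp add: N_def)
          then show ?case using U(3)[of x y] step N_sub by (auto simp: A_def)
        qed (use u in simp)
      qed
      then show ?thesis using U by blast
    qed
  next
    show "\<exists>f. (\<exists>u\<in>V. f u \<noteq> 0) \<and> (\<forall>u\<in>V. A.op f u = s * f u)"
      using ev[of s] spec[of s] by simp
  next
    show "\<theta> \<in> {s, 1, - t}" if "\<exists>u\<in>V. f u \<noteq> 0" "\<And>u. u \<in> V \<Longrightarrow> A.op f u = \<theta> * f u" for \<theta> f
      using ev[of \<theta>] spec[of \<theta>] that by blast
  qed (use assms(1,8) in \<open>simp_all add: A_def\<close>)
  obtain \<alpha> where \<alpha>: "\<And>u. u \<in> V \<Longrightarrow> 0 < \<alpha> u"
      "\<And>u. u \<in> V \<Longrightarrow> (\<Sum>w\<in>V. A u w * \<alpha> w) = s * \<alpha> u"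
      "\<And>u v. u \<in> V \<Longrightarrow> v \<in> V \<Longrightarrow>
        (\<Sum>w\<in>V. A u w * A w v) + (t - 1) * A u v - t * of_bool (u = v) = \<alpha> u * \<alpha> v"
    using A.ex_rank_one by blast
  have sum_N: "(\<Sum>w\<in>V. A u w * f w) = (\<Sum>w\<in>N u. f w)" for u and f :: "'v \<Rightarrow> real"
    unfolding A_def using fin N_sub
    by (intro sum.mono_neutral_cong_right) auto
  have square: "(\<Sum>w\<in>V. A u w * A w v) = real (card (N u \<inter> N v))" for u v
  proof -
    have "(\<Sum>w\<in>V. A u w * A w v) = (\<Sum>w\<in>N u. of_bool (w \<in> N v))"
      unfolding sum_N by (simp add: A_def N_sym)
    then show ?thesis using fin_N by (simp add: of_bool_def sum.If_cases)
  qed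
  \<comment> \<open>The diagonal of the rank-one identity, where \<open>A u u = 0\<close>.\<close>
  have deg: "real (card (N u)) = t + \<alpha> u * \<alpha> u" if "u \<in> V" for u
    using \<alpha>(3)[OF that that] N_irrefl unfolding square by (simp add: A_def)
  obtain x0 where x0: "x0 \<in> V" "out_degree G x0 = min_valency G"
  proof -
    have "min_valency G \<in> valencies G"
      unfolding min_valency_def valencies_def using fin strong(1) by (intro Min_in) (auto simp: V_def)
    then show ?thesis using that by (auto simp: valencies_def V_def)
  qed
  have "\<exists>r T a S. scaled_graph_small V N r T a S x0"
  proof (rule ex_integral_scaling[where \<alpha> = \<alpha> and s = s and t = t])
    show "real (card (N u \<inter> N v)) = \<alpha> u * \<alpha> v - t + 1" if "u \<in> V" "v \<in> N u" for u v
    proof -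
      have "u \<noteq> v" "v \<in> V" using that N_irrefl N_sub by auto
      then show ?thesis using \<alpha>(3)[of u v] that unfolding square by (simp add: A_def)
    qed
    show "real (card (N u \<inter> N v)) = \<alpha> u * \<alpha> v" if "u \<in> V" "v \<in> V" "u \<noteq> v" "v \<notin> N u" for u v
      using \<alpha>(3)[of u v] that unfolding square by (simp add: A_def)
    show "(\<Sum>v\<in>N u. \<alpha> v) = s * \<alpha> u" if "u \<in> V" for u
      using \<alpha>(2)[OF that] unfolding sum_N .
    show "\<exists>v\<in>V. v \<noteq> u \<and> v \<notin> N u" if "u \<in> V" for u
    proof (rule ccontr)
      assume "\<not> ?thesis"
      then have "N u = V - {u}" using N_sub N_irrefl by blast
      then have "out_degree G u = card V - 1" using that fin by (simp add: out_deg)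
      then show False using assms(10) that by (auto simp: cone_def V_def)
    qed
    \<comment> \<open>The minimum valency is \<open>t + \<alpha> x0 * \<alpha> x0\<close> and is
      assumed to be below \<open>t + 3\<close>.\<close>
    show "\<alpha> x0 * \<alpha> x0 < 3" using small x0(2) deg[OF x0(1)] out_deg[of x0] by simp
  qed (use fin N_sub N_sym N_irrefl deg \<alpha>(1) assms(1) x0(1) in auto)
  then obtain r T a S where "scaled_graph_small V N r T a S x0" by blast
  then interpret scaled_graph_small V N r T a S x0 .
  obtain p q where pq: "\<And>u. u \<in> V \<Longrightarrow> r u = p \<or> r u = q" using at_most_two_weights by blast
  \<comment> \<open>The valency depends only on the weight, so two weights allow at most two
    valencies.\<close>
  define h where "h w = nat (T + a * w * w)" for w
  have "out_degree G u = h (r u)" if "u \<in> V" for u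
    using degree[OF that] by (simp add: h_def out_deg)
  then have sub: "valencies G \<subseteq> {h p, h q}" using pq by (auto simp: valencies_def V_def)
  have "card (valencies G) \<le> 2" using card_mono[OF _ sub] by (simp add: card_insert_if split: if_splits)
  moreover have "card (valencies G) \<noteq> 0"
    using strong(1) fin by (simp add: valencies_def V_def)
  moreover have "card (valencies G) \<noteq> 1"
  proof
    assume "card (valencies G) = 1"
    then obtain k where "valencies G = {k}" by (rule card_1_singletonE)
    then show False using assms(4) by (auto simp: regular_def valencies_def)
  qed
  ultimately show False using assms(11) by (auto simp: biregular_def)
qed

end
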